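(* Let $M$ be a Lorentzian manifold, $o\in M$, and let $H$ be the connected component of the holonomy group of $M$ at $o$. Then the decomposition of $H$ into its indecomposable normal subgroups is unique up to the order.
   Context: A Lorentzian manifold is a pseudo-Riemannian manifold $(M,\langle\cdot,\cdot\rangle)$ whose metric has exactly one direction of one sign (signature $(n-1,1)$, or $(1,n-1)$ with the opposite convention, $n=\dim M$). Holonomy is that of the Levi-Civita connection; $H$ is the identity component of the holonomy group at $o$, acting on the tangent space $M_o$ by linear isometries. "Proper" subspace means nonzero and not the whole space. "Maximal" means maximal under inclusion. $(M_o)^H=\{v\in M_o: hv=v\text{ for all }h\in H\}$. For a subgroup $K\subset H$, a $K$-invariant nondegenerate subspace $V\subset M_o$ is indecomposable (equivalently, $K$ acts indecomposably on $V$) if it is not the orthogonal direct sum of two proper $K$-invariant nondegenerate subspaces; for $K=H$ we just say $V$ is indecomposable. Consider orthogonal decompositions $(\ast)$ $M_o=M_o^0\oplus M_o^1\oplus\cdots\oplus M_o^p$ into $H$-invariant subspaces, with $M_o^0$ a maximal nondegenerate subspace of $(M_o)^H$ and $M_o^1,\dots,M_o^p$ indecomposable. A decomposition of $H$ into indecomposable normal subgroups is an (internal) direct product decomposition $H=H^1\times\cdots\times H^p$ associated with some decomposition $(\ast)$: each $H^i$ is a normal subgroup of $H$, acts trivially on $M_o^k$ for $k\neq i$, and acts indecomposably on $M_o^i$. Uniqueness up to order means that any two such decompositions, possibly associated with different decompositions $(\ast)$, consist of the same subgroups up to permutation. *)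

theory Defs
  imports "HOL-Analysis.Analysis" "HOL-Algebra.Generated_Groups"
begin

section \<open>Smooth manifolds\<close>

text \<open>\<open>Ck_on k S f\<close>, for open \<open>S\<close>: all iterated directional derivatives of \<open>f\<close> of order at most \<open>k\<close>
  exist (as Frechet derivatives) and are continuous on \<open>S\<close>.\<close>

primrec Ck_on :: "nat \<Rightarrow> 'a::real_normed_vector set \<Rightarrow> ('a \<Rightarrow> 'b::real_normed_vector) \<Rightarrow> bool" where
  "Ck_on 0 S f \<longleftrightarrow> continuous_on S f"
| "Ck_on (Suc k) S f \<longleftrightarrow>
     (\<forall>x\<in>S. f differentiable (at x)) \<and> (\<forall>v. Ck_on k S (\<lambda>x. frechet_derivative f (at x) v))"

definition smooth_on :: "'a::real_normed_vector set \<Rightarrow> ('a \<Rightarrow> 'b::real_normed_vector) \<Rightarrow> bool" where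
  "smooth_on S f \<longleftrightarrow> (\<forall>k. Ck_on k S f)"

text \<open>A chart is a pair of a domain and a coordinate map; the values of the coordinate map outside
  the domain are irrelevant.\<close>

type_synonym ('m, 'n) chart = "'m set \<times> ('m \<Rightarrow> real ^ 'n)"

abbreviation dom_of :: "('m, 'n::finite) chart \<Rightarrow> 'm set" where
  "dom_of \<equiv> fst"

abbreviation coord :: "('m, 'n::finite) chart \<Rightarrow> 'm \<Rightarrow> real ^ 'n" where
  "coord \<equiv> snd"

definition coord_inv :: "('m, 'n::finite) chart \<Rightarrow> real ^ 'n \<Rightarrow> 'm" where
  "coord_inv c = inv_into (dom_of c) (coord c)"

definition chart :: "('m::topological_space, 'n::finite) chart \<Rightarrow> bool" where
  "chart c \<longleftrightarrow> open (dom_of c) \<and> open (coord c ` dom_of c) \<and>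
     homeomorphism (dom_of c) (coord c ` dom_of c) (coord c) (coord_inv c)"

definition transition ::
  "('m, 'n::finite) chart \<Rightarrow> ('m, 'n) chart \<Rightarrow> real ^ 'n \<Rightarrow> real ^ 'n" where
  "transition c d = coord d \<circ> coord_inv c"

definition smooth_atlas ::
  "('m::{t2_space, second_countable_topology}, 'n::finite) chart set \<Rightarrow> bool" where
  "smooth_atlas A \<longleftrightarrow> (\<forall>c\<in>A. chart c) \<and> (\<Union>c\<in>A. dom_of c) = UNIV \<and>
     (\<forall>c\<in>A. \<forall>d\<in>A. smooth_on (coord c ` (dom_of c \<inter> dom_of d)) (transition c d))"

text \<open>The differential at \<open>p\<close> of the change of coordinates from \<open>c\<close> to \<open>d\<close>: it turns the components
  in \<open>c\<close> of a tangent vector at \<open>p\<close> into its components in \<open>d\<close>.\<close>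

definition change_comp ::
  "('m, 'n::finite) chart \<Rightarrow> ('m, 'n) chart \<Rightarrow> 'm \<Rightarrow> real ^ 'n \<Rightarrow> real ^ 'n" where
  "change_comp c d p = frechet_derivative (transition c d) (at (coord c p))"


section \<open>Lorentzian metrics\<close>

definition bil :: "real ^ 'n ^ 'n \<Rightarrow> real ^ 'n::finite \<Rightarrow> real ^ 'n \<Rightarrow> real" where
  "bil G u v = u \<bullet> (G *v v)"

definition lorentz_signature :: "real ^ 'n ^ 'n::finite \<Rightarrow> bool" where
  "lorentz_signature G \<longleftrightarrow> transpose G = G \<and>
     (\<exists>(e :: 'n \<Rightarrow> real ^ 'n) i0. \<forall>i j.
        bil G (e i) (e j) = (if i \<noteq> j then 0 else if i = i0 then - 1 else 1))"

text \<open>\<open>g c\<close> is the matrix of components of the metric in the chart \<open>c\<close>, as a function of the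
  coordinates. The sign \<open>s\<close> allows for both sign conventions.\<close>

definition lorentzian_manifold ::
  "('m::{t2_space, second_countable_topology}, 'n::finite) chart set \<Rightarrow>
   (('m, 'n) chart \<Rightarrow> real ^ 'n \<Rightarrow> real ^ 'n ^ 'n) \<Rightarrow> bool" where
  "lorentzian_manifold A g \<longleftrightarrow> smooth_atlas A \<and>
     (\<forall>c\<in>A. smooth_on (coord c ` dom_of c) (g c)) \<and>
     (\<forall>c\<in>A. \<forall>d\<in>A. \<forall>p\<in>dom_of c \<inter> dom_of d. \<forall>u v.
        bil (g c (coord c p)) u v =
        bil (g d (coord d p)) (change_comp c d p u) (change_comp c d p v)) \<and>
     (\<exists>s\<in>{1, - 1}. \<forall>c\<in>A. \<forall>x\<in>coord c ` dom_of c. lorentz_signature (s *\<^sub>R g c x))"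


section \<open>Levi-Civita parallel transport and holonomy\<close>

definition metric_pderiv ::
  "(real ^ 'n \<Rightarrow> real ^ 'n ^ 'n) \<Rightarrow> real ^ 'n \<Rightarrow> 'n::finite \<Rightarrow> 'n \<Rightarrow> 'n \<Rightarrow> real" where
  "metric_pderiv G x i j l = frechet_derivative G (at x) (axis i 1) $ j $ l"

definition christoffel ::
  "(real ^ 'n \<Rightarrow> real ^ 'n ^ 'n) \<Rightarrow> real ^ 'n \<Rightarrow> 'n::finite \<Rightarrow> 'n \<Rightarrow> 'n \<Rightarrow> real" where
  "christoffel G x k i j =
     (1 / 2) * (\<Sum>l\<in>UNIV. matrix_inv (G x) $ k $ l *
       (metric_pderiv G x i j l + metric_pderiv G x j i l - metric_pderiv G x l i j))"

definition christoffel_form ::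
  "(real ^ 'n \<Rightarrow> real ^ 'n ^ 'n) \<Rightarrow> real ^ 'n::finite \<Rightarrow> real ^ 'n \<Rightarrow> real ^ 'n \<Rightarrow> real ^ 'n" where
  "christoffel_form G x u v =
     (\<chi> k. \<Sum>i\<in>UNIV. \<Sum>j\<in>UNIV. christoffel G x k i j * u $ i * v $ j)"

text \<open>Smoothness of a curve on a closed interval: it extends smoothly to an open neighbourhood.\<close>

definition smooth_curve ::
  "('m::topological_space, 'n::finite) chart set \<Rightarrow> (real \<Rightarrow> 'm) \<Rightarrow> real \<Rightarrow> real \<Rightarrow> bool" where
  "smooth_curve A \<gamma> a b \<longleftrightarrow>
     (\<exists>J \<delta>. open J \<and> {a..b} \<subseteq> J \<and> continuous_on J \<delta> \<and> (\<forall>t\<in>{a..b}. \<delta> t = \<gamma> t) \<and>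
        (\<forall>c\<in>A. smooth_on {t \<in> J. \<delta> t \<in> dom_of c} (coord c \<circ> \<delta>)))"

definition piecewise_smooth_curve ::
  "('m::topological_space, 'n::finite) chart set \<Rightarrow> (real \<Rightarrow> 'm) \<Rightarrow> bool" where
  "piecewise_smooth_curve A \<gamma> \<longleftrightarrow> continuous_on {0..1} \<gamma> \<and>
     (\<exists>S. finite S \<and>
        (\<forall>a b. 0 \<le> a \<and> a < b \<and> b \<le> 1 \<and> {a<..<b} \<inter> S = {} \<longrightarrow> smooth_curve A \<gamma> a b))"

text \<open>\<open>V c t\<close> are the components in the chart \<open>c\<close> of a vector tangent at \<open>\<gamma> t\<close>; they are relevant only
  if \<open>\<gamma> t\<close> lies in the domain of \<open>c\<close>. The field is parallel for the Levi-Civita connection: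
  \<open>dV\<^sup>k/dt = - \<Sum>\<^sub>i\<^sub>j \<Gamma>\<^sup>k\<^sub>i\<^sub>j (d\<gamma>\<^sup>i/dt) V\<^sup>j\<close> except at finitely many times, where \<open>V\<close> is still continuous.\<close>

definition parallel_along ::
  "('m::topological_space, 'n::finite) chart set \<Rightarrow>
   (('m, 'n) chart \<Rightarrow> real ^ 'n \<Rightarrow> real ^ 'n ^ 'n) \<Rightarrow> (real \<Rightarrow> 'm) \<Rightarrow>
   (('m, 'n) chart \<Rightarrow> real \<Rightarrow> real ^ 'n) \<Rightarrow> bool" where
  "parallel_along A g \<gamma> V \<longleftrightarrow>
     (\<forall>c\<in>A. \<forall>d\<in>A. \<forall>t\<in>{0..1}. \<gamma> t \<in> dom_of c \<inter> dom_of d \<longrightarrow>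
        V d t = change_comp c d (\<gamma> t) (V c t)) \<and>
     (\<forall>c\<in>A. continuous_on {t \<in> {0..1}. \<gamma> t \<in> dom_of c} (V c)) \<and>
     (\<exists>S. finite S \<and> (\<forall>c\<in>A. \<forall>t\<in>{0..1} - S. \<gamma> t \<in> dom_of c \<longrightarrow>
        (V c has_vector_derivative
           - christoffel_form (g c) (coord c (\<gamma> t))
               (vector_derivative (coord c \<circ> \<gamma>) (at t within {0..1})) (V c t))
          (at t within {0..1})))"

text \<open>The tangent space at \<open>b\<close> is identified with \<^typ>\<open>real ^ 'n\<close> by means of a chart \<open>c\<close> around \<open>b\<close>, so
  that the holonomy group at \<open>b\<close> becomes a group of matrices.\<close>

definition holonomy ::
  "('m::topological_space, 'n::finite) chart set \<Rightarrow>
   (('m, 'n) chart \<Rightarrow> real ^ 'n \<Rightarrow> real ^ 'n ^ 'n) \<Rightarrow> ('m, 'n) chart \<Rightarrow> 'm \<Rightarrow> (real ^ 'n ^ 'n) set" where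
  "holonomy A g c b =
     {P. \<exists>\<gamma>. piecewise_smooth_curve A \<gamma> \<and> \<gamma> 0 = b \<and> \<gamma> 1 = b \<and>
        (\<forall>v. \<exists>V. parallel_along A g \<gamma> V \<and> V c 0 = v \<and> V c 1 = P *v v)}"

text \<open>The identity component of the holonomy group for its Lie group topology. That topology may be
  strictly finer than the one induced from the space of matrices, in which connected components
  can then be too large. Path components do not have this problem: an arcwise connected subgroup
  of a Lie group is an immersed Lie subgroup (Yamabe), and the holonomy group has countably many
  components, so both topologies have the same path component of the identity.\<close>

definition holonomy0 ::
  "('m::topological_space, 'n::finite) chart set \<Rightarrow>
   (('m, 'n) chart \<Rightarrow> real ^ 'n \<Rightarrow> real ^ 'n ^ 'n) \<Rightarrow> ('m, 'n) chart \<Rightarrow> 'm \<Rightarrow> (real ^ 'n ^ 'n) set" where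
  "holonomy0 A g c b = path_component_set (holonomy A g c b) (mat 1)"


section \<open>Indecomposable decompositions\<close>

text \<open>In this section \<open>B\<close> is the scalar product on the tangent space and \<open>K\<close>, \<open>H\<close> are groups of
  matrices.\<close>

definition nondegenerate_subspace ::
  "(real ^ 'n \<Rightarrow> real ^ 'n \<Rightarrow> real) \<Rightarrow> (real ^ 'n::finite) set \<Rightarrow> bool" where
  "nondegenerate_subspace B V \<longleftrightarrow> subspace V \<and> (\<forall>v\<in>V. (\<forall>w\<in>V. B v w = 0) \<longrightarrow> v = 0)"

definition invariant_under :: "(real ^ 'n ^ 'n) set \<Rightarrow> (real ^ 'n::finite) set \<Rightarrow> bool" where
  "invariant_under K V \<longleftrightarrow> (\<forall>h\<in>K. \<forall>v\<in>V. h *v v \<in> V)"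

definition acts_trivially :: "(real ^ 'n ^ 'n) set \<Rightarrow> (real ^ 'n::finite) set \<Rightarrow> bool" where
  "acts_trivially K V \<longleftrightarrow> (\<forall>h\<in>K. \<forall>v\<in>V. h *v v = v)"

definition fixed_vectors :: "(real ^ 'n ^ 'n) set \<Rightarrow> (real ^ 'n::finite) set" where
  "fixed_vectors K = {v. \<forall>h\<in>K. h *v v = v}"

definition orthogonal_sets ::
  "(real ^ 'n \<Rightarrow> real ^ 'n \<Rightarrow> real) \<Rightarrow> (real ^ 'n::finite) set \<Rightarrow> (real ^ 'n) set \<Rightarrow> bool" where
  "orthogonal_sets B U W \<longleftrightarrow> (\<forall>u\<in>U. \<forall>w\<in>W. B u w = 0)"

text \<open>The zero space is not indecomposable.\<close>

definition indecomposable ::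
  "(real ^ 'n \<Rightarrow> real ^ 'n \<Rightarrow> real) \<Rightarrow> (real ^ 'n ^ 'n) set \<Rightarrow> (real ^ 'n::finite) set \<Rightarrow> bool" where
  "indecomposable B K V \<longleftrightarrow>
     nondegenerate_subspace B V \<and> invariant_under K V \<and> V \<noteq> {0} \<and>
     \<not> (\<exists>U W. nondegenerate_subspace B U \<and> invariant_under K U \<and> U \<noteq> {0} \<and> U \<noteq> V \<and>
              nondegenerate_subspace B W \<and> invariant_under K W \<and> W \<noteq> {0} \<and> W \<noteq> V \<and>
              orthogonal_sets B U W \<and> U \<inter> W = {0} \<and> V = {u + w | u w. u \<in> U \<and> w \<in> W})"

definition maximal_nondegenerate_in ::
  "(real ^ 'n \<Rightarrow> real ^ 'n \<Rightarrow> real) \<Rightarrow> (real ^ 'n::finite) set \<Rightarrow> (real ^ 'n) set \<Rightarrow> bool" where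
  "maximal_nondegenerate_in B F V \<longleftrightarrow> nondegenerate_subspace B V \<and> V \<subseteq> F \<and>
     (\<forall>U. nondegenerate_subspace B U \<and> U \<subseteq> F \<and> V \<subseteq> U \<longrightarrow> U = V)"

definition tangent_decomposition ::
  "(real ^ 'n \<Rightarrow> real ^ 'n \<Rightarrow> real) \<Rightarrow> (real ^ 'n ^ 'n) set \<Rightarrow> nat \<Rightarrow>
   (nat \<Rightarrow> (real ^ 'n::finite) set) \<Rightarrow> bool" where
  "tangent_decomposition B H p D \<longleftrightarrow>
     (\<forall>i\<le>p. subspace (D i) \<and> invariant_under H (D i)) \<and>
     (\<forall>v. \<exists>!f. f \<in> (\<Pi>\<^sub>E i\<in>{..p}. D i) \<and> v = (\<Sum>i\<le>p. f i)) \<and>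
     (\<forall>i\<le>p. \<forall>j\<le>p. i \<noteq> j \<longrightarrow> orthogonal_sets B (D i) (D j)) \<and>
     maximal_nondegenerate_in B (fixed_vectors H) (D 0) \<and>
     (\<forall>i\<in>{1..p}. indecomposable B H (D i))"

definition matrix_group :: "(real ^ 'n ^ 'n) set \<Rightarrow> (real ^ 'n ^ 'n::finite) monoid" where
  "matrix_group H = \<lparr>carrier = H, mult = (\<lambda>h k. h ** k), one = mat 1\<rparr>"

definition internal_direct_product :: "('a, 'b) monoid_scheme \<Rightarrow> 'i set \<Rightarrow> ('i \<Rightarrow> 'a set) \<Rightarrow> bool" where
  "internal_direct_product G I K \<longleftrightarrow> group G \<and> (\<forall>i\<in>I. K i \<lhd> G) \<and>
     generate G (\<Union>i\<in>I. K i) = carrier G \<and>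
     (\<forall>i\<in>I. K i \<inter> generate G (\<Union>j\<in>I - {i}. K j) = {\<one>\<^bsub>G\<^esub>})"

definition indecomposable_normal_decomposition ::
  "(real ^ 'n \<Rightarrow> real ^ 'n \<Rightarrow> real) \<Rightarrow> (real ^ 'n ^ 'n) set \<Rightarrow> nat \<Rightarrow>
   (nat \<Rightarrow> (real ^ 'n ^ 'n::finite) set) \<Rightarrow> bool" where
  "indecomposable_normal_decomposition B H p K \<longleftrightarrow>
     (\<exists>D. tangent_decomposition B H p D \<and>
        internal_direct_product (matrix_group H) {1..p} K \<and>
        (\<forall>i\<in>{1..p}. (\<forall>k\<le>p. k \<noteq> i \<longrightarrow> acts_trivially (K i) (D k)) \<and> indecomposable B (K i) (D i)))"

end

theory Submission
  imports Defs
begin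

text \<open>Let \<open>\<pi>\<^sub>a\<close> and \<open>\<rho>\<^sub>k\<close> be the projections of two decompositions \<open>D\<close> and \<open>E\<close> of the tangent space.
  For \<open>b \<noteq> a\<close> the map \<open>\<pi>\<^sub>a \<rho>\<^sub>k\<close> takes \<open>D b\<close> to \<open>H\<close>-fixed vectors of \<open>D a\<close>, because
  every factor of \<open>H\<close> acts trivially on \<open>D b\<close> or on \<open>D a\<close>. If \<open>D a\<close> has no nonzero fixed vector, this
  map vanishes, and so does its adjoint \<open>\<pi>\<^sub>b \<rho>\<^sub>k \<pi>\<^sub>a\<close>; thus every \<open>\<rho>\<^sub>k\<close> preserves \<open>D a\<close>, and
  indecomposability gives \<open>D a = E k\<close> for some \<open>k\<close>. By maximality of \<open>D 0\<close>, fixed vectors in the other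
  summands are isotropic, so in Lorentzian signature at most one summand \<open>D a\<close>, \<open>a \<ge> 1\<close>, has nonzero
  fixed vectors. This summand need not be unique, but its subgroup is: it consists of the elements
  of \<open>H\<close> that act trivially on all the summands that are unique.\<close>

section \<open>Projections of an orthogonal decomposition\<close>

text \<open>Lorentzian signature enters through \<open>isotropic_parallel\<close>, which says that
  totally isotropic subspaces have dimension at most one. It holds for both sign
  conventions.\<close>

locale orthogonal_splitting =
  fixes B :: "real ^ 'n \<Rightarrow> real ^ 'n::finite \<Rightarrow> real"
    and H :: "(real ^ 'n ^ 'n) set" and p :: nat
    and D :: "nat \<Rightarrow> (real ^ 'n) set" and K :: "nat \<Rightarrow> (real ^ 'n ^ 'n) set"
  assumes bilinear: "bilinear B"
    and sym: "B u v = B v u"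
    and isotropic_parallel:
      "\<lbrakk>B u u = 0; B w w = 0; B u w = 0; u \<noteq> 0\<rbrakk> \<Longrightarrow> \<exists>r. w = r *\<^sub>R u"
    and decomposition: "tangent_decomposition B H p D"
    and direct_product: "internal_direct_product (matrix_group H) {1..p} K"
    and trivial: "\<lbrakk>i \<in> {1..p}; k \<le> p; k \<noteq> i\<rbrakk> \<Longrightarrow> acts_trivially (K i) (D k)"
begin

text \<open>These are the projections \<pi> and \<rho> of the idea. As \<open>part v\<close> is an
  element of an extensional product, its values beyond \<open>p\<close> are
  \<open>undefined\<close>; hence the bounds on the index in what follows.\<close>

definition part :: "real ^ 'n \<Rightarrow> nat \<Rightarrow> real ^ 'n" where
  "part v = (THE f. f \<in> (\<Pi>\<^sub>E i\<in>{..p}. D i) \<and> v = (\<Sum>i\<le>p. f i))"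

lemmas B_simps = bilinear_ladd[OF bilinear] bilinear_radd[OF bilinear] bilinear_lsub[OF bilinear]
  bilinear_rsub[OF bilinear] bilinear_lzero[OF bilinear] bilinear_rzero[OF bilinear]
  bilinear_lmul[OF bilinear] bilinear_rmul[OF bilinear]

lemma B_sum_right: "B u (\<Sum>i\<in>I. f i) = (\<Sum>i\<in>I. B u (f i))"
  using bilinear by (simp add: bilinear_def linear_sum)

lemma subspace_D: "i \<le> p \<Longrightarrow> subspace (D i)"
  and invariant_D: "i \<le> p \<Longrightarrow> h \<in> H \<Longrightarrow> v \<in> D i \<Longrightarrow> h *v v \<in> D i"
  and orthogonal_D: "i \<le> p \<Longrightarrow> j \<le> p \<Longrightarrow> i \<noteq> j \<Longrightarrow> u \<in> D i \<Longrightarrow> v \<in> D j \<Longrightarrow> B u v = 0"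
  and maximal_D0: "maximal_nondegenerate_in B (fixed_vectors H) (D 0)"
  and indecomposable_D: "i \<in> {1..p} \<Longrightarrow> indecomposable B H (D i)"
  using decomposition
  unfolding tangent_decomposition_def invariant_under_def orthogonal_sets_def by auto

lemma zero_in_D: "i \<le> p \<Longrightarrow> 0 \<in> D i"
  using subspace_D by (rule subspace_0)

lemma D_nonzero: "i \<in> {1..p} \<Longrightarrow> D i \<noteq> {0}"
  using indecomposable_D unfolding indecomposable_def by blast

lemma D0_fixed: "D 0 \<subseteq> fixed_vectors H"
  using maximal_D0 by (simp add: maximal_nondegenerate_in_def)

lemma nondegenerate_D: "i \<le> p \<Longrightarrow> nondegenerate_subspace B (D i)"
  using maximal_D0 indecomposable_D[of i]
  by (cases "i = 0") (auto simp: maximal_nondegenerate_in_def indecomposable_def)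

lemma nondegenerate_DD: "i \<le> p \<Longrightarrow> v \<in> D i \<Longrightarrow> (\<And>w. w \<in> D i \<Longrightarrow> B v w = 0) \<Longrightarrow> v = 0"
  using nondegenerate_D unfolding nondegenerate_subspace_def by blast

lemma part_props: "part v \<in> (\<Pi>\<^sub>E i\<in>{..p}. D i) \<and> v = (\<Sum>i\<le>p. part v i)"
proof -
  have "\<exists>!f. f \<in> (\<Pi>\<^sub>E i\<in>{..p}. D i) \<and> v = (\<Sum>i\<le>p. f i)"
    using decomposition unfolding tangent_decomposition_def by blast
  from theI'[OF this] show ?thesis unfolding part_def .
qed

lemma part_in: "i \<le> p \<Longrightarrow> part v i \<in> D i"
  using part_props[of v] by auto

lemma part_sum: "(\<Sum>i\<le>p. part v i) = v"
  using part_props[of v] by simp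

lemma part_unique:
  assumes "\<And>i. i \<le> p \<Longrightarrow> f i \<in> D i" and "v = (\<Sum>i\<le>p. f i)" and "i \<le> p"
  shows "part v i = f i"
proof -
  have "\<exists>!f. f \<in> (\<Pi>\<^sub>E i\<in>{..p}. D i) \<and> v = (\<Sum>i\<le>p. f i)"
    using decomposition unfolding tangent_decomposition_def by blast
  moreover have "restrict f {..p} \<in> (\<Pi>\<^sub>E i\<in>{..p}. D i) \<and> v = (\<Sum>i\<le>p. restrict f {..p} i)"
    using assms by auto
  ultimately have "part v = restrict f {..p}"
    using part_props[of v] by blast
  then show ?thesis using assms by simp
qed

lemma part_diff: "i \<le> p \<Longrightarrow> part (u - v) i = part u i - part v i"
  by (rule part_unique[where f = "\<lambda>i. part u i - part v i"])
    (simp_all add: sum_subtractf part_sum subspace_diff subspace_D part_in)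

lemma part_add: "i \<le> p \<Longrightarrow> part (u + v) i = part u i + part v i"
  by (rule part_unique[where f = "\<lambda>i. part u i + part v i"])
    (simp_all add: sum.distrib part_sum subspace_add subspace_D part_in)

lemma part_scaleR: "i \<le> p \<Longrightarrow> part (r *\<^sub>R v) i = r *\<^sub>R part v i"
  by (rule part_unique[where f = "\<lambda>i. r *\<^sub>R part v i"])
    (simp_all add: part_sum subspace_scale subspace_D part_in flip: scaleR_sum_right)

lemma part_zero: "i \<le> p \<Longrightarrow> part 0 i = 0"
  using part_scaleR[of i 0 0] by simp

lemma part_of_mem:
  assumes "v \<in> D j" "j \<le> p" "i \<le> p"
  shows "part v i = (if i = j then v else 0)"
  by (rule part_unique[where f = "\<lambda>i. if i = j then v else 0"]) (use assms zero_in_D in simp_all)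

lemma part_part: "i \<le> p \<Longrightarrow> part (part v i) i = part v i"
  using part_of_mem[OF part_in] by simp

lemma mem_D_if_parts_zero:
  assumes "i \<le> p" and "\<And>j. j \<le> p \<Longrightarrow> j \<noteq> i \<Longrightarrow> part v j = 0"
  shows "v \<in> D i"
proof -
  have "v = (\<Sum>j\<le>p. part v j)" by (simp add: part_sum)
  also have "\<dots> = (\<Sum>j\<le>p. if j = i then part v i else 0)"
    using assms by (intro sum.cong) auto
  also have "\<dots> = part v i" using assms(1) by simp
  finally show ?thesis using part_in[OF assms(1), of v] by simp
qed

lemma D_disjoint: "\<lbrakk>i \<le> p; j \<le> p; i \<noteq> j; v \<in> D i; v \<in> D j\<rbrakk> \<Longrightarrow> v = 0"
  using part_of_mem[of v i i] part_of_mem[of v j i] by simp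

lemma part_equivariant: "\<lbrakk>h \<in> H; i \<le> p\<rbrakk> \<Longrightarrow> part (h *v v) i = h *v part v i"
  by (rule part_unique[where f = "\<lambda>i. h *v part v i"])
    (simp_all add: part_sum invariant_D part_in flip: linear_sum[OF matrix_vector_mul_linear])

text \<open>Since the summands are mutually orthogonal, both sides equal
  \<open>B (part v i) (part w i)\<close>: the projections are self-adjoint.\<close>

lemma part_adjoint:
  assumes "i \<le> p"
  shows "B (part v i) w = B v (part w i)"
proof -
  have *: "B (part x i) y = B (part x i) (part y i)" for x y
  proof -
    have "B (part x i) y = (\<Sum>j\<le>p. B (part x i) (part y j))"
      by (simp add: part_sum flip: B_sum_right)
    also have "\<dots> = (\<Sum>j\<le>p. if j = i then B (part x i) (part y i) else 0)"
      using assms orthogonal_D[OF assms _ _ part_in[OF assms] part_in] by (intro sum.cong) auto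
    finally show ?thesis using assms by simp
  qed
  show ?thesis
    using *[of v w] *[of w v] sym[of "part v i" "part w i"] sym[of "part w i" v] by simp
qed

text \<open>On \<open>X\<close> the projection to \<open>D k\<close> is a self-adjoint idempotent
  commuting with \<open>H\<close>. So \<open>X\<close> is the orthogonal sum of its image
  \<open>U\<close> and its kernel \<open>W\<close>, and one of the two must be trivial.\<close>

lemma indecomposable_part:
  assumes X: "indecomposable B H X" and k: "k \<le> p"
    and preserved: "\<And>x. x \<in> X \<Longrightarrow> part x k \<in> X"
  shows "X \<subseteq> D k \<or> (\<forall>x\<in>X. part x k = 0)"
proof (rule ccontr)
  assume contra: "\<not> ?thesis"
  define U where "U = X \<inter> D k"
  define W where "W = {x \<in> X. part x k = 0}"
  have X': "subspace X" "\<And>v. v \<in> X \<Longrightarrow> (\<And>w. w \<in> X \<Longrightarrow> B v w = 0) \<Longrightarrow> v = 0"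
    "\<And>h v. h \<in> H \<Longrightarrow> v \<in> X \<Longrightarrow> h *v v \<in> X"
    using X unfolding indecomposable_def nondegenerate_subspace_def invariant_under_def by auto
  have part_U: "part u k = u" if "u \<in> U" for u
    using that k part_of_mem[of u k k] by (simp add: U_def)
  have part_in_U: "part x k \<in> U" if "x \<in> X" for x
    using that k preserved part_in by (simp add: U_def)
  have rest_in_W: "x - part x k \<in> W" if "x \<in> X" for x
    using that k preserved subspace_diff[OF X'(1)] by (simp add: W_def part_diff part_part)
  have "subspace U"
    unfolding U_def using X'(1) subspace_D[OF k] by (rule subspace_inter)
  moreover have "subspace W"
    unfolding W_def subspace_def
    using X'(1) k by (auto simp: part_add part_scaleR part_zero subspace_0 subspace_add subspace_scale)
  \<comment> \<open>A vector of \<open>U\<close> orthogonal to \<open>U\<close> is orthogonal to all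
    of \<open>X\<close>, because self-adjointness makes it orthogonal to \<open>W\<close> as well;
    then nondegeneracy of \<open>X\<close> applies. The same reasoning serves \<open>W\<close>
    below.\<close>
  moreover have "u = 0" if "u \<in> U" "\<forall>w\<in>U. B u w = 0" for u
  proof (rule X'(2))
    show "u \<in> X" using that by (simp add: U_def)
    show "B u w = 0" if "w \<in> X" for w
      using part_adjoint[OF k, of u w] part_U[OF \<open>u \<in> U\<close>] part_in_U[OF that]
        \<open>\<forall>w\<in>U. B u w = 0\<close> by simp
  qed
  moreover have "u = 0" if "u \<in> W" "\<forall>w\<in>W. B u w = 0" for u
  proof (rule X'(2))
    show "u \<in> X" using that by (simp add: W_def)
    show "B u w = 0" if "w \<in> X" for w
    proof -
      have "B u (w - part w k) = 0" using rest_in_W[OF that] \<open>\<forall>w\<in>W. B u w = 0\<close> by blast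
      moreover have "B u (part w k) = 0"
        using \<open>u \<in> W\<close> part_adjoint[OF k, of u w] by (simp add: W_def B_simps)
      ultimately show ?thesis by (simp add: B_simps)
    qed
  qed
  ultimately have "nondegenerate_subspace B U" "nondegenerate_subspace B W"
    unfolding nondegenerate_subspace_def by auto
  moreover have "invariant_under H U" "invariant_under H W"
    unfolding invariant_under_def U_def W_def
    using X'(3) k by (auto simp: part_equivariant intro: invariant_D)
  moreover have "orthogonal_sets B U W"
    unfolding orthogonal_sets_def
  proof (intro ballI)
    fix u w assume "u \<in> U" "w \<in> W"
    then show "B u w = 0"
      using part_U[of u] part_adjoint[OF k, of u w] by (simp add: W_def B_simps)
  qed
  moreover have "U \<inter> W = {0}"
    using part_U subspace_0[OF \<open>subspace U\<close>] subspace_0[OF \<open>subspace W\<close>] by (auto simp: W_def)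
  moreover have "X = {u + w | u w. u \<in> U \<and> w \<in> W}"
  proof
    show "X \<subseteq> {u + w | u w. u \<in> U \<and> w \<in> W}"
    proof
      fix x assume "x \<in> X"
      then show "x \<in> {u + w | u w. u \<in> U \<and> w \<in> W}"
        using part_in_U rest_in_W by (intro CollectI exI[of _ "part x k"] exI[of _ "x - part x k"]) auto
    qed
    show "{u + w | u w. u \<in> U \<and> w \<in> W} \<subseteq> X"
      using X'(1) by (auto simp: U_def W_def intro: subspace_add)
  qed
  moreover have "U \<noteq> {0}" "W \<noteq> X"
    using contra part_in_U by (auto simp: W_def)
  moreover have "U \<noteq> X" "W \<noteq> {0}"
  proof -
    show "U \<noteq> X" using contra by (auto simp: U_def)
    obtain x where x: "x \<in> X" "x \<notin> D k" using contra by blast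
    then have "x - part x k \<noteq> 0" using part_in[OF k, of x] by auto
    then show "W \<noteq> {0}" using rest_in_W[OF x(1)] by auto
  qed
  ultimately have "\<exists>U W. nondegenerate_subspace B U \<and> invariant_under H U \<and> U \<noteq> {0} \<and> U \<noteq> X \<and>
      nondegenerate_subspace B W \<and> invariant_under H W \<and> W \<noteq> {0} \<and> W \<noteq> X \<and>
      orthogonal_sets B U W \<and> U \<inter> W = {0} \<and> X = {u + w | u w. u \<in> U \<and> w \<in> W}"
    by (intro exI[of _ U] exI[of _ W] conjI)
  then show False
    using X unfolding indecomposable_def by (elim conjE notE)
qed


section \<open>Fixed vectors and the factors of the group\<close>

text \<open>If \<open>B v v\<close> were nonzero, the sum of \<open>D 0\<close> and the line through
  \<open>v\<close> would be a larger nondegenerate space of fixed vectors, against the maximality of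
  \<open>D 0\<close>.\<close>

lemma isotropic_fixed:
  assumes a: "a \<in> {1..p}" and v: "v \<in> D a" "v \<in> fixed_vectors H"
  shows "B v v = 0"
proof (rule ccontr)
  assume nz: "B v v \<noteq> 0"
  define U where "U = {d + r *\<^sub>R v | d r. d \<in> D 0}"
  have orth: "B d v = 0" if "d \<in> D 0" for d
    using orthogonal_D[of 0 a d v] a v that by auto
  have D0_U: "D 0 \<subseteq> U"
  proof
    fix d assume "d \<in> D 0"
    then show "d \<in> U" unfolding U_def by (intro CollectI exI[of _ d] exI[of _ 0]) simp
  qed
  have v_U: "v \<in> U"
    unfolding U_def by (intro CollectI exI[of _ 0] exI[of _ 1]) (simp add: zero_in_D)
  have "U = {x + y | x y. x \<in> D 0 \<and> y \<in> span {v}}"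
    by (auto simp: U_def span_singleton)
  then have "subspace U"
    using subspace_sums[OF subspace_D[of 0] subspace_span[of "{v}"]] by simp
  moreover have "u = 0" if u: "u \<in> U" "\<forall>w\<in>U. B u w = 0" for u
  proof -
    obtain d r where d: "d \<in> D 0" "u = d + r *\<^sub>R v" using u by (auto simp: U_def)
    have "B u v = 0" using u v_U by blast
    then have "r = 0" using d orth nz by (simp add: B_simps)
    then have "u \<in> D 0" using d by simp
    then show "u = 0"
      using u(2) D0_U by (intro nondegenerate_DD[of 0]) auto
  qed
  moreover have "U \<subseteq> fixed_vectors H"
    using D0_fixed v(2)
    by (auto simp: U_def fixed_vectors_def matrix_vector_right_distrib matrix_vector_mult_scaleR)
  ultimately have "U = D 0"
    using maximal_D0 D0_U unfolding maximal_nondegenerate_in_def nondegenerate_subspace_def by blast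
  then have "v = 0" using D_disjoint[of 0 a v] a v v_U by auto
  then show False using nz by (simp add: B_simps)
qed

text \<open>Otherwise every vector of \<open>D a\<close> would be isotropic, and by polarization
  \<open>B\<close> would vanish on the nonzero nondegenerate space \<open>D a\<close>.\<close>

lemma not_all_fixed:
  assumes a: "a \<in> {1..p}"
  shows "\<not> D a \<subseteq> fixed_vectors H"
proof
  assume fixed: "D a \<subseteq> fixed_vectors H"
  have sub: "subspace (D a)" using a subspace_D by simp
  have iso: "B v v = 0" if "v \<in> D a" for v
    using isotropic_fixed[OF a that] fixed that by blast
  have "v = 0" if "v \<in> D a" for v
  proof (rule nondegenerate_DD)
    show "B v w = 0" if "w \<in> D a" for w
      using iso[of "v + w"] iso[of v] iso[of w] that \<open>v \<in> D a\<close> sub sym[of w v]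
      by (simp add: B_simps subspace_add)
  qed (use a that in auto)
  then show False using D_nonzero[OF a] zero_in_D[of a] a by auto
qed

text \<open>These summands will turn out to be common to both decompositions. The range of
  \<open>a\<close> keeps out \<open>D 0\<close>, which satisfies the second condition when it is
  zero.\<close>

definition fixed_free :: "nat \<Rightarrow> bool" where
  "fixed_free a \<longleftrightarrow> a \<in> {1..p} \<and> D a \<inter> fixed_vectors H \<subseteq> {0}"

text \<open>Nonzero fixed vectors of two such summands are isotropic and orthogonal to each other,
  hence parallel, whereas distinct summands meet only in zero. This is where the signature is
  used.\<close>

lemma not_fixed_free_unique:
  assumes "a \<in> {1..p}" "a' \<in> {1..p}" "\<not> fixed_free a" "\<not> fixed_free a'"
  shows "a = a'"
proof (rule ccontr)
  assume neq: "a \<noteq> a'"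
  obtain u where u: "u \<in> D a" "u \<in> fixed_vectors H" "u \<noteq> 0"
    using assms by (auto simp: fixed_free_def)
  obtain w where w: "w \<in> D a'" "w \<in> fixed_vectors H" "w \<noteq> 0"
    using assms by (auto simp: fixed_free_def)
  obtain r where "w = r *\<^sub>R u"
    using isotropic_parallel[of u w] isotropic_fixed[of a u] isotropic_fixed[of a' w]
      orthogonal_D[of a a' u w] assms u w neq by auto
  then have "w \<in> D a" using u assms subspace_scale[OF subspace_D[of a]] by auto
  then show False using D_disjoint[of a a' w] assms w neq by auto
qed

section \<open>The direct product structure of \<open>H\<close> and its action on the
  summands\<close>

lemma group_H: "group (matrix_group H)"
  using direct_product by (simp add: internal_direct_product_def)

lemma normal_K: "i \<in> {1..p} \<Longrightarrow> K i \<lhd> matrix_group H"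
  using direct_product by (simp add: internal_direct_product_def)

lemma subgroup_K: "i \<in> {1..p} \<Longrightarrow> subgroup (K i) (matrix_group H)"
  using normal_K by (rule normal_imp_subgroup)

lemma K_subset: "i \<in> {1..p} \<Longrightarrow> K i \<subseteq> H"
  using subgroup.subset[OF subgroup_K] by (simp add: matrix_group_def)

lemma mult_closed: "h \<in> H \<Longrightarrow> k \<in> H \<Longrightarrow> h ** k \<in> H"
  using monoid.m_closed[OF group.is_monoid[OF group_H]] by (simp add: matrix_group_def)

lemma one_closed: "mat 1 \<in> H"
  using monoid.one_closed[OF group.is_monoid[OF group_H]] by (simp add: matrix_group_def)

lemma K_mult_closed: "i \<in> {1..p} \<Longrightarrow> h \<in> K i \<Longrightarrow> k \<in> K i \<Longrightarrow> h ** k \<in> K i"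
  using subgroup.m_closed[OF subgroup_K] by (simp add: matrix_group_def)

lemma K_one: "i \<in> {1..p} \<Longrightarrow> mat 1 \<in> K i"
  using subgroup.one_closed[OF subgroup_K] by (simp add: matrix_group_def)

text \<open>Induction along the generation of \<open>H\<close> by its factors. Inverses get no case
  of their own because each \<open>K i\<close> is closed under them.\<close>

lemma H_induct [consumes 1, case_names one factor mult]:
  assumes "h \<in> H" and one: "P (mat 1)"
    and factor: "\<And>i h. i \<in> {1..p} \<Longrightarrow> h \<in> K i \<Longrightarrow> P h"
    and mult: "\<And>h k. \<lbrakk>h \<in> H; k \<in> H; P h; P k\<rbrakk> \<Longrightarrow> P (h ** k)"
  shows "P h"
proof -
  have gen: "generate (matrix_group H) (\<Union>i\<in>{1..p}. K i) = H"
    using direct_product by (simp add: internal_direct_product_def matrix_group_def)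
  with assms(1) have "h \<in> generate (matrix_group H) (\<Union>i\<in>{1..p}. K i)" by simp
  then show ?thesis
  proof induction
    case one
    then show ?case using \<open>P (mat 1)\<close> by (simp add: matrix_group_def)
  next
    case (incl h)
    then show ?case using factor by blast
  next
    case (inv h)
    then show ?case using factor subgroup.m_inv_closed[OF subgroup_K] by blast
  next
    case (eng h k)
    then show ?case using mult gen by (simp add: matrix_group_def)
  qed
qed

text \<open>The factors other than \<open>K a\<close> act trivially on \<open>D a\<close>, where
  \<open>T x\<close> lies; \<open>K a\<close> acts trivially on \<open>D b\<close>, where
  \<open>x\<close> lies, and equivariance carries this over to \<open>T x\<close>.\<close>

lemma image_in_other_summand_fixed:
  assumes "a \<le> p" "b \<le> p" "a \<noteq> b" "x \<in> D b" "T x \<in> D a"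
    and equivariant: "\<And>h. h \<in> H \<Longrightarrow> T (h *v x) = h *v T x"
  shows "T x \<in> fixed_vectors H"
proof -
  have "h *v T x = T x" if "h \<in> H" for h
    using that
  proof (induction rule: H_induct)
    case one
    then show ?case by simp
  next
    case (factor i h)
    then have "h \<in> H" using K_subset by blast
    show ?case
    proof (cases "i = a")
      case True
      then have "h *v x = x"
        using trivial[of i b] factor assms unfolding acts_trivially_def by auto
      then show ?thesis using equivariant[OF \<open>h \<in> H\<close>] by simp
    next
      case False
      then show ?thesis
        using trivial[of i a] factor assms unfolding acts_trivially_def by auto
    qed
  next
    case (mult h k)
    then show ?case by (simp flip: matrix_vector_mul_assoc)
  qed
  then show ?thesis by (simp add: fixed_vectors_def)
qed

text \<open>All factors other than \<open>K a\<close> act trivially on \<open>D a\<close>, and since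
  \<open>K a\<close> is normal, its elements can be collected at the front of any product.\<close>

lemma factorization:
  assumes "h \<in> H" and a: "a \<in> {1..p}"
  shows "\<exists>k\<in>K a. \<exists>m\<in>H. h = k ** m \<and> (\<forall>v\<in>D a. m *v v = v)"
  using assms(1)
proof (induction rule: H_induct)
  case one
  show ?case using K_one[OF a] one_closed by (intro bexI[of _ "mat 1"]) auto
next
  case (factor i h)
  show ?case
  proof (cases "i = a")
    case True
    then show ?thesis using factor one_closed by (intro bexI[of _ h] bexI[of _ "mat 1"]) auto
  next
    case False
    then have "\<forall>v\<in>D a. h *v v = v"
      using trivial[of i a] factor a unfolding acts_trivially_def by auto
    then show ?thesis
      using factor K_subset K_one[OF a] by (intro bexI[of _ "mat 1"] bexI[of _ h]) auto
  qed
next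
  case (mult h h')
  then obtain k m k' m' where
    k: "k \<in> K a" "m \<in> H" "h = k ** m" "\<forall>v\<in>D a. m *v v = v" and
    k': "k' \<in> K a" "m' \<in> H" "h' = k' ** m'" "\<forall>v\<in>D a. m' *v v = v" by metis
  define n where "n = inv\<^bsub>matrix_group H\<^esub> m"
  have n: "n \<in> H" "n ** m = mat 1"
    using group.inv_closed[OF group_H, of m] group.l_inv[OF group_H, of m] k(2)
    by (auto simp: matrix_group_def n_def)
  \<comment> \<open>Moving \<open>m\<close> past \<open>k'\<close> replaces \<open>k'\<close> by its
    conjugate, with \<open>n\<close> the inverse of \<open>m\<close>.\<close>
  have "m ** k' ** n \<in> K a"
    using normal.inv_op_closed2[OF normal_K[OF a], of m k'] k k' by (simp add: matrix_group_def n_def)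
  moreover have "h ** h' = (k ** (m ** k' ** n)) ** (m ** m')"
    using n k k' by (metis matrix_mul_assoc matrix_mul_lid)
  moreover have "\<forall>v\<in>D a. (m ** m') *v v = v"
    using k k' by (simp flip: matrix_vector_mul_assoc)
  ultimately show ?case
    using k k' K_mult_closed[OF a] mult_closed by blast
qed

text \<open>This determines \<open>K a\<close> from \<open>H\<close> and \<open>D a\<close> alone,
  so a summand common to two decompositions has the same factor in both.\<close>

lemma mem_K_iff:
  assumes a: "a \<in> {1..p}"
  shows "h \<in> K a \<longleftrightarrow> h \<in> H \<and> (\<forall>v. h *v v - v \<in> D a)"
proof -
  have le: "a \<le> p" using a by simp
  have forward: "h *v v - v \<in> D a" if "h \<in> K a" for h v
  proof (rule mem_D_if_parts_zero[OF le])
    fix j assume j: "j \<le> p" "j \<noteq> a"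
    have "h \<in> H" using K_subset a that by blast
    moreover have "h *v part v j = part v j"
      using trivial[OF a j] that part_in[OF j(1)] unfolding acts_trivially_def by blast
    ultimately show "part (h *v v - v) j = 0"
      using j by (simp add: part_diff part_equivariant)
  qed
  have "h \<in> K a" if h: "h \<in> H" and D: "\<And>v. h *v v - v \<in> D a"
  proof -
    obtain k m where k: "k \<in> K a" "m \<in> H" "h = k ** m" "\<forall>v\<in>D a. m *v v = v"
      using factorization[OF h a] by blast
    \<comment> \<open>Both \<open>h\<close> and \<open>k\<close> move vectors only along
      \<open>D a\<close>, hence so does \<open>m\<close>; but the component of
      \<open>m *v v - v\<close> in \<open>D a\<close> vanishes because \<open>m\<close> fixes
      \<open>D a\<close> pointwise.\<close>
    have "m *v v = v" for v
    proof -
      have "m *v v - v = (h *v v - v) - (k *v (m *v v) - m *v v)"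
        using k(3) by (simp flip: matrix_vector_mul_assoc)
      also have "\<dots> \<in> D a"
        using D forward[OF k(1)] subspace_diff[OF subspace_D[OF le]] by blast
      finally have "m *v v - v = part (m *v v - v) a"
        using part_of_mem[of "m *v v - v" a a] le by simp
      also have "\<dots> = m *v part v a - part v a"
        using k(2) le by (simp add: part_diff part_equivariant)
      also have "\<dots> = 0" using k(4) part_in[OF le] by simp
      finally show ?thesis by simp
    qed
    then have "m = mat 1" by (simp add: matrix_eq)
    then show ?thesis using k by simp
  qed
  then show ?thesis using forward K_subset a by blast
qed

text \<open>This determines \<open>K a\<close> from the other summands, without mention of
  \<open>D a\<close>, which may differ between decompositions. The summand \<open>D 0\<close> is
  fixed by all of \<open>H\<close>.\<close>

lemma mem_K_iff_trivial:
  assumes a: "a \<in> {1..p}"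
  shows "h \<in> K a \<longleftrightarrow> h \<in> H \<and> (\<forall>b\<in>{1..p} - {a}. \<forall>v\<in>D b. h *v v = v)"
proof
  assume "h \<in> K a"
  then show "h \<in> H \<and> (\<forall>b\<in>{1..p} - {a}. \<forall>v\<in>D b. h *v v = v)"
    using K_subset a trivial[OF a] unfolding acts_trivially_def by auto
next
  assume h: "h \<in> H \<and> (\<forall>b\<in>{1..p} - {a}. \<forall>v\<in>D b. h *v v = v)"
  have "h *v v - v \<in> D a" for v
  proof (rule mem_D_if_parts_zero)
    fix j assume j: "j \<le> p" "j \<noteq> a"
    have "h *v part v j = part v j"
    proof (cases "j = 0")
      case True
      then show ?thesis using D0_fixed part_in[of 0 v] h by (auto simp: fixed_vectors_def)
    next
      case False
      then have "j \<in> {1..p} - {a}" using j by simp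
      then show ?thesis using h part_in[OF j(1)] by blast
    qed
    then show "part (h *v v - v) j = 0" using h j by (simp add: part_diff part_equivariant)
  qed (use a in simp)
  then show "h \<in> K a" using h mem_K_iff[OF a] by simp
qed

end


section \<open>Comparison of two decompositions\<close>

locale two_splittings =
  S: orthogonal_splitting B H p D K + T: orthogonal_splitting B H q E L
  for B :: "real ^ 'n \<Rightarrow> real ^ 'n::finite \<Rightarrow> real" and H p D K q E L
begin

text \<open>The component of \<open>T.part x k\<close> in \<open>D b\<close> is tested against
  \<open>w\<close> in \<open>D b\<close>. Self-adjointness moves the projections over to
  \<open>w\<close>, and the component of \<open>T.part w k\<close> in \<open>D a\<close> is a fixed
  vector of \<open>D a\<close>, hence zero.\<close>

lemma part_preserves_fixed_free:
  assumes a: "S.fixed_free a" and k: "k \<le> q" and x: "x \<in> D a"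
  shows "T.part x k \<in> D a"
proof (rule S.mem_D_if_parts_zero)
  show le: "a \<le> p" using a by (simp add: S.fixed_free_def)
  fix b assume b: "b \<le> p" "b \<noteq> a"
  show "S.part (T.part x k) b = 0"
  proof (rule S.nondegenerate_DD[OF b(1) S.part_in[OF b(1)]])
    fix w assume w: "w \<in> D b"
    have "S.part (T.part w k) a \<in> fixed_vectors H"
    proof (rule S.image_in_other_summand_fixed[where T = "\<lambda>y. S.part (T.part y k) a"])
      show "S.part (T.part (h *v w) k) a = h *v S.part (T.part w k) a" if "h \<in> H" for h
        using that le k by (simp add: S.part_equivariant T.part_equivariant)
    qed (use le b w S.part_in in auto)
    then have zero: "S.part (T.part w k) a = 0"
      using a S.part_in[OF le] by (auto simp: S.fixed_free_def)
    have "B (S.part (T.part x k) b) w = B x (T.part w k)"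
      using S.part_of_mem[OF w b(1) b(1)] S.part_adjoint[OF b(1)] T.part_adjoint[OF k] by simp
    also have "\<dots> = B x (S.part (T.part w k) a)"
      using S.part_of_mem[OF x le le] S.part_adjoint[OF le, of x] by simp
    finally show "B (S.part (T.part x k) b) w = 0"
      using zero by (simp add: S.B_simps)
  qed
qed

lemma fixed_free_common:
  assumes a: "S.fixed_free a"
  shows "\<exists>k. T.fixed_free k \<and> D a = E k"
proof -
  have a': "a \<in> {1..p}" "a \<le> p" using a by (auto simp: S.fixed_free_def)
  obtain x where x: "x \<in> D a" "x \<noteq> 0"
    using S.D_nonzero[OF a'(1)] S.zero_in_D[OF a'(2)] by blast
  have "\<exists>k\<le>q. T.part x k \<noteq> 0"
  proof (rule ccontr)
    assume "\<not> ?thesis"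
    then show False using T.part_sum[of x] x(2) by simp
  qed
  then obtain k where k: "k \<le> q" "T.part x k \<noteq> 0" by blast
  have sub: "D a \<subseteq> E k"
    using T.indecomposable_part[OF S.indecomposable_D[OF a'(1)] k(1)]
      part_preserves_fixed_free[OF a k(1)] x k(2) by blast
  \<comment> \<open>\<open>E 0\<close> consists of fixed vectors, but \<open>D a\<close> does
    not.\<close>
  have "k \<noteq> 0"
    using sub T.D0_fixed S.not_all_fixed[OF a'(1)] by auto
  then have k': "k \<in> {1..q}" using k by simp
  \<comment> \<open>As \<open>D a\<close> lies in \<open>E k\<close>, the projection to
    \<open>D a\<close> maps \<open>E k\<close> into itself, so the indecomposability of
    \<open>E k\<close> can be used in turn.\<close>
  have "E k \<subseteq> D a \<or> (\<forall>y\<in>E k. S.part y a = 0)"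
    using S.indecomposable_part[OF T.indecomposable_D[OF k'] a'(2)] S.part_in[OF a'(2)] sub by blast
  moreover have "S.part x a \<noteq> 0"
    using S.part_of_mem[OF x(1) a'(2) a'(2)] x by simp
  ultimately have "D a = E k" using sub x by blast
  then show ?thesis
    using a k' by (auto simp: T.fixed_free_def S.fixed_free_def)
qed

text \<open>A summand \<open>D a\<close> with nonzero fixed vectors would be orthogonal to all the
  common summands. If these exhaust the \<open>E k\<close> with \<open>k\<close> positive, then
  \<open>D a\<close> lies in \<open>E 0\<close> and is fixed pointwise, which is impossible. The
  premise \<open>common\<close> is to be supplied by exchanging the two decompositions.\<close>

lemma all_fixed_free:
  assumes "\<And>k. k \<in> {1..q} \<Longrightarrow> T.fixed_free k"
    and common: "\<And>k. T.fixed_free k \<Longrightarrow> \<exists>a. S.fixed_free a \<and> E k = D a"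
    and a: "a \<in> {1..p}"
  shows "S.fixed_free a"
proof (rule ccontr)
  assume not_free: "\<not> S.fixed_free a"
  have "D a \<subseteq> E 0"
  proof
    fix x assume x: "x \<in> D a"
    show "x \<in> E 0"
    proof (rule T.mem_D_if_parts_zero)
      fix k assume k: "k \<le> q" "k \<noteq> 0"
      then obtain b where b: "S.fixed_free b" "E k = D b"
        using assms(1)[of k] common by auto
      show "T.part x k = 0"
      proof (rule T.nondegenerate_DD[OF k(1) T.part_in[OF k(1)]])
        fix w assume w: "w \<in> E k"
        have "B (T.part x k) w = B x w"
          using T.part_adjoint[OF k(1)] T.part_of_mem[OF w k(1) k(1)] by simp
        also have "\<dots> = 0"
          using S.orthogonal_D[of a b x w] not_free a b w x by (auto simp: S.fixed_free_def)
        finally show "B (T.part x k) w = 0" .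
      qed
    qed simp
  qed
  then show False using T.D0_fixed S.not_all_fixed[OF a] by blast
qed

text \<open>Common summands are matched by equality. On each side at most one summand remains, and
  these two are matched whether or not they coincide.\<close>

definition matching :: "nat \<Rightarrow> nat \<Rightarrow> bool" where
  "matching a k \<longleftrightarrow> a \<in> {1..p} \<and> k \<in> {1..q} \<and>
     (if S.fixed_free a then T.fixed_free k \<and> D a = E k else \<not> T.fixed_free k)"

lemma matching_inj:
  assumes "matching a k" "matching a' k"
  shows "a = a'"
proof (cases "S.fixed_free a")
  case True
  then have D: "D a = D a'" using assms by (auto simp: matching_def split: if_splits)
  have a: "a \<in> {1..p}" "a' \<in> {1..p}" using assms by (auto simp: matching_def)
  then have "0 \<in> D a" using S.zero_in_D by simp
  then obtain x where "x \<in> D a" "x \<noteq> 0"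
    using S.D_nonzero[OF a(1)] by blast
  then show ?thesis using a D S.D_disjoint[of a a' x] by auto
next
  case False
  then show ?thesis
    using assms S.not_fixed_free_unique[of a a'] by (auto simp: matching_def split: if_splits)
qed

lemma symmetric: "two_splittings B H q E L p D K"
  by unfold_locales

lemma matching_symmetric: "two_splittings.matching H q E p D k a \<longleftrightarrow> matching a k"
  by (auto simp: two_splittings.matching_def[OF symmetric] matching_def)

lemma matching_exists:
  assumes a: "a \<in> {1..p}"
  shows "\<exists>k. matching a k"
proof (cases "S.fixed_free a")
  case True
  then show ?thesis
    using fixed_free_common[OF True] a by (auto simp: matching_def T.fixed_free_def)
next
  case False
  then obtain k where "k \<in> {1..q}" "\<not> T.fixed_free k"
    using all_fixed_free[OF _ two_splittings.fixed_free_common[OF symmetric] a] by blast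
  then show ?thesis using False a by (auto simp: matching_def)
qed

text \<open>For a common summand both factors have the same description by \<open>mem_K_iff\<close>.
  Otherwise every \<open>E j\<close> with \<open>j\<close> positive and different from
  \<open>k\<close> is some \<open>D b\<close> with \<open>b\<close> different from \<open>a\<close>,
  on which \<open>h\<close> acts trivially.\<close>

lemma matching_subset:
  assumes m: "matching a k" and h: "h \<in> K a"
  shows "h \<in> L k"
proof (cases "S.fixed_free a")
  case True
  then show ?thesis using m h by (simp add: matching_def S.mem_K_iff T.mem_K_iff)
next
  case False
  have "h *v v = v" if j: "j \<in> {1..q} - {k}" and v: "v \<in> E j" for j v
  proof -
    have "T.fixed_free j"
      using False m j T.not_fixed_free_unique[of j k] by (auto simp: matching_def)
    then obtain b where "S.fixed_free b" "E j = D b"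
      using two_splittings.fixed_free_common[OF symmetric] by blast
    moreover from this have "b \<in> {1..p} - {a}" using False by (auto simp: S.fixed_free_def)
    ultimately show ?thesis
      using h m v by (auto simp: matching_def S.mem_K_iff_trivial)
  qed
  then show ?thesis
    using m h by (simp add: matching_def S.mem_K_iff_trivial T.mem_K_iff_trivial)
qed

theorem same_factors: "\<exists>\<sigma>. bij_betw \<sigma> {1..p} {1..q} \<and> (\<forall>i\<in>{1..p}. L (\<sigma> i) = K i)"
proof -
  \<comment> \<open>Exchanging the roles yields surjectivity and the reverse inclusions of
    factors.\<close>
  interpret R: two_splittings B H q E L p D K by (rule symmetric)
  obtain \<sigma> where \<sigma>: "\<And>a. a \<in> {1..p} \<Longrightarrow> matching a (\<sigma> a)"
    using matching_exists by metis
  have "bij_betw \<sigma> {1..p} {1..q}"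
    unfolding bij_betw_def
  proof (intro conjI subset_antisym)
    show "inj_on \<sigma> {1..p}"
      using \<sigma> matching_inj by (metis inj_onI)
    show "\<sigma> ` {1..p} \<subseteq> {1..q}"
      using \<sigma> by (auto simp: matching_def)
    show "{1..q} \<subseteq> \<sigma> ` {1..p}"
    proof
      fix k assume "k \<in> {1..q}"
      then obtain a where a: "matching a k"
        using R.matching_exists matching_symmetric by blast
      then have "a \<in> {1..p}" by (simp add: matching_def)
      moreover from this a have "k = \<sigma> a"
        using R.matching_inj \<sigma> matching_symmetric by blast
      ultimately show "k \<in> \<sigma> ` {1..p}" by blast
    qed
  qed
  moreover have "L (\<sigma> i) = K i" if "i \<in> {1..p}" for i
    using \<sigma>[OF that] matching_subset R.matching_subset matching_symmetric by blast
  ultimately show ?thesis by blast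
qed

end


section \<open>Lorentzian scalar products\<close>

lemma bilinear_bil: "bilinear (bil G)"
  unfolding bilinear_def bil_def
  by (auto intro!: linearI simp: inner_add_left inner_add_right matrix_vector_right_distrib
      matrix_vector_mult_scaleR)

lemma bil_commute: "transpose G = G \<Longrightarrow> bil G u v = bil G v u"
  unfolding bil_def by (metis dot_lmul_matrix inner_commute transpose_matrix_vector)

lemma bil_scaleR: "bil (s *\<^sub>R G) u v = s * bil G u v"
  by (simp add: bil_def flip: scaleR_matrix_vector_assoc)

text \<open>The orthogonal complement of the timelike vector \<open>e i0\<close> is positive
  definite: there the coefficient at \<open>e i0\<close> vanishes and \<open>bil G v v\<close> is
  the sum of the squares of the coefficients.\<close>

lemma lorentz_definite_complement:
  fixes e :: "'n::finite \<Rightarrow> real ^ 'n"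
  assumes e: "\<And>i j. bil G (e i) (e j) = (if i \<noteq> j then 0 else if i = i0 then - 1 else 1)"
    and v: "bil G v (e i0) = 0" "bil G v v = 0"
  shows "v = 0"
proof -
  note G = bilinear_bil[of G]
  have inner_e: "bil G (\<Sum>i\<in>UNIV. c i *\<^sub>R e i) (e j) = c j * bil G (e j) (e j)" for c j
  proof -
    have "bil G (\<Sum>i\<in>UNIV. c i *\<^sub>R e i) (e j) = (\<Sum>i\<in>UNIV. c i * bil G (e i) (e j))"
      using G by (simp add: bilinear_def linear_sum[of "\<lambda>x. bil G x (e j)"] bilinear_lmul[OF G])
    also have "\<dots> = (\<Sum>i\<in>UNIV. if i = j then c j * bil G (e j) (e j) else 0)"
      by (intro sum.cong) (auto simp: e)
    finally show ?thesis by simp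
  qed
  have inj: "inj e"
  proof (rule injI, rule ccontr)
    fix i j assume "e i = e j" "i \<noteq> j"
    then have "bil G (e i) (e i) = 0" using e[of i j] by simp
    then show False by (simp add: e split: if_splits)
  qed
  \<comment> \<open>Pairing a linear relation with \<open>e j\<close> isolates its coefficient at
    \<open>e j\<close>. Counting dimensions then shows that the \<open>e j\<close> span the
    space.\<close>
  have "independent (range e)"
  proof (rule independent_if_scalars_zero)
    fix f x assume f: "(\<Sum>x\<in>range e. f x *\<^sub>R x) = 0" and "x \<in> range e"
    then obtain j where j: "x = e j" by blast
    have "(\<Sum>i\<in>UNIV. f (e i) *\<^sub>R e i) = 0"
      using f by (simp add: sum.reindex[OF inj])
    then have "f (e j) * bil G (e j) (e j) = 0"
      using inner_e[of "\<lambda>i. f (e i)" j] by (simp add: bilinear_lzero[OF G])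
    then show "f x = 0" using j by (simp add: e split: if_splits)
  qed simp
  then have "v \<in> span (range e)"
    using card_ge_dim_independent[of "range e" UNIV] by (auto simp: card_image inj dim_UNIV)
  then obtain f where "v = (\<Sum>x\<in>range e. f x *\<^sub>R x)"
    by (auto simp: span_finite)
  then obtain c where c: "v = (\<Sum>i\<in>UNIV. c i *\<^sub>R e i)"
    by (simp add: sum.reindex[OF inj])
  have "c i0 = 0"
    using v(1) inner_e[of c i0] by (simp add: c e)
  have "bil G v v = (\<Sum>i\<in>UNIV. c i * bil G v (e i))"
    using G by (subst (2) c) (simp add: bilinear_def linear_sum bilinear_rmul[OF G])
  also have "\<dots> = (\<Sum>i\<in>UNIV. (c i)\<^sup>2)"
    using inner_e[of c] \<open>c i0 = 0\<close> unfolding c[symmetric]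
    by (intro sum.cong) (auto simp: e power2_eq_square)
  finally have "c i = 0" for i
    using v(2) by (simp add: sum_nonneg_eq_0_iff)
  then show ?thesis by (simp add: c)
qed

lemma lorentz_isotropic_parallel:
  fixes G :: "real ^ 'n ^ 'n::finite"
  assumes "lorentz_signature G" and u: "bil G u u = 0" and w: "bil G w w = 0"
    and uw: "bil G u w = 0" and "u \<noteq> 0"
  shows "\<exists>r. w = r *\<^sub>R u"
proof -
  obtain e :: "'n \<Rightarrow> real ^ 'n" and i0 where sym: "transpose G = G"
    and e: "\<And>i j. bil G (e i) (e j) = (if i \<noteq> j then 0 else if i = i0 then - 1 else 1)"
    using assms(1) unfolding lorentz_signature_def by blast
  define x where "x = bil G u (e i0)"
  define y where "y = bil G w (e i0)"
  note simps = bilinear_lsub[OF bilinear_bil] bilinear_rsub[OF bilinear_bil]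
    bilinear_lmul[OF bilinear_bil] bilinear_rmul[OF bilinear_bil]
  have "x \<noteq> 0"
    using lorentz_definite_complement[OF e, of u] u \<open>u \<noteq> 0\<close> x_def by auto
  \<comment> \<open>The factor \<open>y / x\<close> makes the difference orthogonal to
    \<open>e i0\<close>. Being a combination of orthogonal isotropic vectors, the difference is also
    isotropic, hence zero.\<close>
  have "w - (y / x) *\<^sub>R u = 0"
    using \<open>x \<noteq> 0\<close> u w uw bil_commute[OF sym, of w u]
    by (intro lorentz_definite_complement[OF e]) (auto simp: simps x_def y_def)
  then show ?thesis by auto
qed

theorem corollary4p2:
  fixes A :: "('m::{t2_space, second_countable_topology}, 'n::finite) chart set"
    and g :: "('m, 'n) chart \<Rightarrow> real ^ 'n \<Rightarrow> real ^ 'n ^ 'n"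
    and c :: "('m, 'n) chart" and b :: 'm
    and H :: "(real ^ 'n ^ 'n) set"
    and B :: "real ^ 'n \<Rightarrow> real ^ 'n \<Rightarrow> real"
    and p q :: nat
    and K L :: "nat \<Rightarrow> (real ^ 'n ^ 'n) set"
  assumes "lorentzian_manifold A g"
    and "c \<in> A" and "b \<in> dom_of c"
    and "H = holonomy0 A g c b"
    and "B = bil (g c (coord c b))"
    and "indecomposable_normal_decomposition B H p K"
    and "indecomposable_normal_decomposition B H q L"
  shows "\<exists>\<sigma>. bij_betw \<sigma> {1..p} {1..q} \<and> (\<forall>i\<in>{1..p}. L (\<sigma> i) = K i)"
proof -
  let ?G = "g c (coord c b)"
  obtain s :: real where s: "s \<in> {1, - 1}" "lorentz_signature (s *\<^sub>R ?G)"
    using assms(1-3) unfolding lorentzian_manifold_def by blast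
  \<comment> \<open>Symmetry and the vanishing conditions on \<open>B\<close> are unaffected by the
    nonzero factor \<open>s\<close>, so both sign conventions are treated at once.\<close>
  have scale: "bil (s *\<^sub>R ?G) u v = s * B u v" for u v
    by (simp add: assms(5) bil_scaleR)
  have "s \<noteq> 0" using s by auto
  have sym: "B u v = B v u" for u v
    using bil_commute[of "s *\<^sub>R ?G" u v] s(2) \<open>s \<noteq> 0\<close> by (simp add: lorentz_signature_def scale)
  have par: "\<exists>r. w = r *\<^sub>R u" if "B u u = 0" "B w w = 0" "B u w = 0" "u \<noteq> 0" for u w
    using lorentz_isotropic_parallel[OF s(2), of u w] that by (simp add: scale)
  have split: "\<exists>D. orthogonal_splitting B H m D M"
    if M: "indecomposable_normal_decomposition B H m M" for m M
  proof -
    obtain D where D: "tangent_decomposition B H m D"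
      "internal_direct_product (matrix_group H) {1..m} M"
      "\<forall>i\<in>{1..m}. \<forall>k\<le>m. k \<noteq> i \<longrightarrow> acts_trivially (M i) (D k)"
      using M unfolding indecomposable_normal_decomposition_def by blast
    have "orthogonal_splitting B H m D M"
    proof
      show "bilinear B" using bilinear_bil assms(5) by simp
    qed (use D sym par in auto)
    then show ?thesis by blast
  qed
  obtain D E where "orthogonal_splitting B H p D K" "orthogonal_splitting B H q E L"
    using split assms(6,7) by meson
  then have "two_splittings B H p D K q E L" by (simp add: two_splittings_def)
  then show ?thesis by (rule two_splittings.same_factors)
qed

end
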